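(* Let $k\in\mathbb{N}$, let $A$ and $B$ be $C^*$-algebras, and let $h:A\to B$ be a bounded linear map that is a $k$-Jordan homomorphism, i.e. $h(a^k)=(h(a))^k$ for all $a\in A$. Suppose that $h$ is involution preserving, i.e. $h(a^* )=h(a)^*$ for all $a\in A$, and that $h(a^*a)=h(a)^*h(a)$ for all $a\in A$. Then $h$ is norm contractive, i.e. $\|h\|\leq 1$.
   Context: $C^*$-algebras are complex, not assumed unital and not assumed commutative. $\|h\|$ denotes the operator norm of $h$. *)

theory Defs
  imports "HOL-Analysis.Analysis"
begin

text \<open>
  The class \<open>real_normed_algebra\<close> assumes neither a unit nor commutativity.  The complex scalar
  multiplication is required to extend the real one, so that the norm, completeness and
  \<open>onorm\<close> of the library apply unchanged.
\<close>

class complex_vector = real_vector +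
  fixes scaleC :: "complex \<Rightarrow> 'a \<Rightarrow> 'a"  (infixr "*\<^sub>C" 75)
  assumes scaleR_scaleC: "r *\<^sub>R x = complex_of_real r *\<^sub>C x"
    and scaleC_add_right: "c *\<^sub>C (x + y) = c *\<^sub>C x + c *\<^sub>C y"
    and scaleC_add_left: "(c + d) *\<^sub>C x = c *\<^sub>C x + d *\<^sub>C x"
    and scaleC_scaleC: "c *\<^sub>C d *\<^sub>C x = (c * d) *\<^sub>C x"
    and scaleC_one: "1 *\<^sub>C x = x"

class complex_banach_algebra = complex_vector + real_normed_algebra + banach +
  assumes norm_scaleC: "norm (c *\<^sub>C x) = cmod c * norm x"
    and mult_scaleC_left: "(c *\<^sub>C x) * y = c *\<^sub>C (x * y)"
    and mult_scaleC_right: "x * (c *\<^sub>C y) = c *\<^sub>C (x * y)"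

class cstar_algebra = complex_banach_algebra +
  fixes star :: "'a \<Rightarrow> 'a"  ("(_\<^sup>\<star>)" [1000] 999)
  assumes star_star: "(x\<^sup>\<star>)\<^sup>\<star> = x"
    and star_add: "(x + y)\<^sup>\<star> = x\<^sup>\<star> + y\<^sup>\<star>"
    and star_scaleC: "(c *\<^sub>C x)\<^sup>\<star> = cnj c *\<^sub>C x\<^sup>\<star>"
    and star_mult: "(x * y)\<^sup>\<star> = y\<^sup>\<star> * x\<^sup>\<star>"
    and cstar_identity: "norm (x\<^sup>\<star> * x) = (norm x)\<^sup>2"

instantiation complex :: cstar_algebra
begin

definition scaleC_complex :: "complex \<Rightarrow> complex \<Rightarrow> complex"
  where "scaleC_complex c x = c * x"

definition star_complex :: "complex \<Rightarrow> complex"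
  where "star_complex x = cnj x"

instance
  by standard
    (simp_all add: scaleC_complex_def star_complex_def scaleR_conv_of_real norm_mult
      algebra_simps power2_eq_square)

end

definition bounded_clinear :: "('a::cstar_algebra \<Rightarrow> 'b::cstar_algebra) \<Rightarrow> bool"
  where "bounded_clinear h \<longleftrightarrow> bounded_linear h \<and> (\<forall>c x. h (c *\<^sub>C x) = c *\<^sub>C h x)"

text \<open>
  The \<open>k\<close>-fold product \<open>a * \<dots> * a\<close>, for \<open>k \<ge> 1\<close>.  The library power needs a unit
  element, which is not available here; the value at \<open>k = 0\<close> is meaningless.
\<close>

definition kpower :: "'a::semigroup_mult \<Rightarrow> nat \<Rightarrow> 'a"
  where "kpower a k = (((*) a) ^^ (k - 1)) a"

lemma kpower_1: "kpower a 1 = a"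
  by (simp add: kpower_def)

lemma kpower_Suc: "k \<ge> 1 \<Longrightarrow> kpower a (Suc k) = a * kpower a k"
  by (cases k) (simp_all add: kpower_def)

lemma kpower_eq_power:
  fixes a :: "'a::monoid_mult"
  assumes "k \<ge> 1"
  shows "kpower a k = a ^ k"
  using assms
proof (induction k rule: dec_induct)
  case base
  show ?case by (simp add: kpower_def)
next
  case (step n)
  then show ?case by (simp only: kpower_Suc power_Suc)
qed

definition k_Jordan_homomorphism :: "nat \<Rightarrow> ('a::semigroup_mult \<Rightarrow> 'b::semigroup_mult) \<Rightarrow> bool"
  where "k_Jordan_homomorphism k h \<longleftrightarrow> (\<forall>a. h (kpower a k) = kpower (h a) k)"

end

theory Submission
  imports Defs
begin

text \<open>
  Write \<open>M\<close> for the operator norm of \<open>h\<close>.  By the \<open>C\<^sup>*\<close>-identity, first in the target and then in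
  the domain, the compatibility of \<open>h\<close> with \<open>x \<mapsto> x\<^sup>\<star> * x\<close> gives
  \<open>\<parallel>h x\<parallel>\<^sup>2 = \<parallel>h (x\<^sup>\<star> * x)\<parallel> \<le> M * \<parallel>x\<^sup>\<star> * x\<parallel> = M * \<parallel>x\<parallel>\<^sup>2\<close>.
  Thus \<open>\<surd>M\<close> is again a bound for \<open>h\<close>, so \<open>M \<le> \<surd>M\<close> by minimality of the operator norm, and
  a nonnegative real with this property is at most \<open>1\<close>.
\<close>

theorem theorem2p7:
  fixes h :: "'a::cstar_algebra \<Rightarrow> 'b::cstar_algebra" and k :: nat
  assumes "k \<ge> 1"
    and "bounded_clinear h"
    and "k_Jordan_homomorphism k h"
    and "\<And>a. h (a\<^sup>\<star>) = (h a)\<^sup>\<star>"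
    and "\<And>a. h (a\<^sup>\<star> * a) = (h a)\<^sup>\<star> * h a"
  shows "onorm h \<le> 1"
proof -
  have bl: "bounded_linear h"
    using assms(2) by (simp add: bounded_clinear_def)
  have pos: "0 \<le> onorm h"
    using bl by (rule onorm_pos_le)
  have "norm (h x) \<le> sqrt (onorm h) * norm x" for x
  proof -
    have "(norm (h x))\<^sup>2 = norm (h (x\<^sup>\<star> * x))"
      by (simp add: assms(5) cstar_identity)
    also have "\<dots> \<le> onorm h * norm (x\<^sup>\<star> * x)"
      using bl by (rule onorm)
    also have "\<dots> = (sqrt (onorm h) * norm x)\<^sup>2"
      using pos by (simp add: cstar_identity power_mult_distrib)
    finally show ?thesis
      by (rule power2_le_imp_le) (simp add: pos)
  qed
  then have "onorm h \<le> sqrt (onorm h)"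
    using pos by (intro onorm_bound) simp_all
  then have "(onorm h)\<^sup>2 \<le> onorm h"
    using pos power_mono[of "onorm h" "sqrt (onorm h)" 2] by simp
  then show ?thesis
    using pos by (cases "onorm h = 0") (simp_all add: power2_eq_square mult_le_cancel_left2)
qed

end
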